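(* Consider the symmetric Test and Find problem with parameters $n,k,m,a,b,(c_i),(d_i)$ (as described in the context). For $s\in\Sigma$ let $M(s)=\sum_{i=1}^n(1-s_i)$. For $s$ with $g_{n,k}(M(s))>0$, writing $x=M(s)$, put $$\alpha_i(s)=\begin{cases} b\,\dfrac{n-k}{x}\,\dfrac{g_{n-1,k}(x-1)}{g_{n,k}(x)}, & s_i=0,\\[2mm] (1-b)\,\dfrac{n-k}{n-x}\,\dfrac{g_{n-1,k}(x)}{g_{n,k}(x)}, & s_i=1,\end{cases}\qquad R_i(s)=c_i-(c_i+d_i)\alpha_i(s).$$ Let $\mathcal I:\Sigma\to\{I\subseteq\{1,\dots,n\}:|I|\le m\}$ be any strategy such that for every $s$ with $g_{n,k}(M(s))>0$ the following holds, where $\ell$ denotes the number of indices $i$ with $R_i(s)>0$: if $\ell\le m$, then $\mathcal I(s)=\{i:R_i(s)>0\}$; if $\ell>m$, then $\mathcal I(s)$ consists of $m$ indices with the largest values of $R_i(s)$ (ties broken arbitrarily). Then $\mathcal I$ maximizes the expected total reward $$\mathrm E\Big[\sum_{i\in\mathcal J(S)}\big(c_i1_{[T_i=1]}-d_i1_{[T_i=0]}\big)\Big]$$ among all strategies $\mathcal J:\Sigma\to\{I\subseteq\{1,\dots,n\}:|I|\le m\}$.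
   Context: Let $n\ge1$, $0\le k\le n$, $1\le m\le n$ be integers, $a,b\in[1/2,1]$, and $c_i,d_i$ real numbers for $i=1,\dots,n$ ($c_i$ is the reward for a correct tag in box $i$, $d_i$ the penalty for a wrong tag). Let $\Gamma=\{\gamma\in\{0,1\}^n:\sum_j\gamma_j=k\}$ and $\Sigma=\{0,1\}^n$. In the symmetric case, $T=(T_1,\dots,T_n)$ is uniformly distributed on $\Gamma$ ($T_i=1$ means box $i$ contains an object). $S=(S_1,\dots,S_n)\in\Sigma$ is the vector of test results. Conditionally on $T=\gamma$, the $S_i$ are independent, with $P(S_i=1|T=\gamma)=a$ if $\gamma_i=1$ and $P(S_i=0|T=\gamma)=b$ if $\gamma_i=0$. The decision maker observes only $S$ and then tags at most $m$ boxes; a strategy is a function assigning to each $s\in\Sigma$ the set of tagged boxes. The total reward is the sum over tagged boxes $i$ of $c_i$ if $T_i=1$ and $-d_i$ if $T_i=0$. For integers $n'\ge k\ge 0$, $g_{n',k}$ denotes the probability mass function of $N_1+N_2$ where $N_1\sim\mathrm{Bin}(k,1-a)$ and $N_2\sim\mathrm{Bin}(n'-k,b)$ are independent. When $k=n$ (so that $g_{n-1,k}$ is not defined) the expressions with factor $n-k=0$ are interpreted as $0$. *)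

theory Defs
  imports "HOL-Probability.Probability"
begin

text \<open>
  Boxes are indexed by \<open>{1..n}\<close>; a \<open>0\<close>-\<open>1\<close> vector is an extensional function on this set, so that
  equality of vectors is equality of functions.
\<close>

definition bin_vecs :: "nat \<Rightarrow> (nat \<Rightarrow> nat) set" where
  "bin_vecs n = {1..n} \<rightarrow>\<^sub>E {0, 1}"

definition placements :: "nat \<Rightarrow> nat \<Rightarrow> (nat \<Rightarrow> nat) set" where
  "placements n k = {\<gamma> \<in> bin_vecs n. (\<Sum>j=1..n. \<gamma> j) = k}"

text \<open>
  Independence conditionally on the event \<open>T = \<gamma>\<close> is independence under the conditional
  measure \<open>P(\<cdot> | T = \<gamma>)\<close>, which is \<^const>\<open>uniform_measure\<close>; for \<open>k \<le> n\<close> this event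
  has positive probability.
\<close>

locale symmetric_test_and_find = prob_space M
  for M :: "'w measure" and n k :: nat and a b :: real
    and T S :: "'w \<Rightarrow> nat \<Rightarrow> nat" +
  assumes T_measurable: "T \<in> M \<rightarrow>\<^sub>M count_space (placements n k)"
    and T_uniform: "distr M (count_space (placements n k)) T = uniform_count_measure (placements n k)"
    and S_measurable: "S \<in> M \<rightarrow>\<^sub>M count_space (bin_vecs n)"
    and S_cond_indep: "\<And>\<gamma>. \<gamma> \<in> placements n k \<Longrightarrow>
      prob_space.indep_vars (uniform_measure M {\<omega> \<in> space M. T \<omega> = \<gamma>})
        (\<lambda>i. count_space {0, 1}) (\<lambda>i \<omega>. S \<omega> i) {1..n}"
    and S_true_positive: "\<And>\<gamma> i. \<gamma> \<in> placements n k \<Longrightarrow> i \<in> {1..n} \<Longrightarrow> \<gamma> i = 1 \<Longrightarrow>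
      \<P>(\<omega> in M. S \<omega> i = 1 \<bar> T \<omega> = \<gamma>) = a"
    and S_true_negative: "\<And>\<gamma> i. \<gamma> \<in> placements n k \<Longrightarrow> i \<in> {1..n} \<Longrightarrow> \<gamma> i = 0 \<Longrightarrow>
      \<P>(\<omega> in M. S \<omega> i = 0 \<bar> T \<omega> = \<gamma>) = b"

definition strategies :: "nat \<Rightarrow> nat \<Rightarrow> ((nat \<Rightarrow> nat) \<Rightarrow> nat set) set" where
  "strategies n m = bin_vecs n \<rightarrow> {I. I \<subseteq> {1..n} \<and> card I \<le> m}"

definition expected_reward ::
  "'w measure \<Rightarrow> ('w \<Rightarrow> nat \<Rightarrow> nat) \<Rightarrow> ('w \<Rightarrow> nat \<Rightarrow> nat) \<Rightarrow> (nat \<Rightarrow> real) \<Rightarrow> (nat \<Rightarrow> real)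
    \<Rightarrow> ((nat \<Rightarrow> nat) \<Rightarrow> nat set) \<Rightarrow> real" where
  "expected_reward M T S c d J =
    (\<integral>\<omega>. (\<Sum>i\<in>J (S \<omega>). c i * of_bool (T \<omega> i = 1) - d i * of_bool (T \<omega> i = 0)) \<partial>M)"

definition num_zeros :: "nat \<Rightarrow> (nat \<Rightarrow> nat) \<Rightarrow> nat" where
  "num_zeros n s = (\<Sum>i=1..n. 1 - s i)"

text \<open>
  The law of the number of negative tests among \<open>n'\<close> boxes of which \<open>k\<close> contain an object.
  For \<open>k > n'\<close> the truncated subtraction yields an irrelevant value: below this happens only
  for \<open>n' = n - 1\<close>, \<open>k = n\<close>, where it is multiplied by \<open>n - k = 0\<close>.
\<close>

definition g :: "real \<Rightarrow> real \<Rightarrow> nat \<Rightarrow> nat \<Rightarrow> nat \<Rightarrow> real" where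
  "g a b n' k = pmf (map_pmf (\<lambda>(N1, N2). N1 + N2)
     (pair_pmf (binomial_pmf k (1 - a)) (binomial_pmf (n' - k) b)))"

definition \<alpha> :: "nat \<Rightarrow> nat \<Rightarrow> real \<Rightarrow> real \<Rightarrow> (nat \<Rightarrow> nat) \<Rightarrow> nat \<Rightarrow> real" where
  "\<alpha> n k a b s i = (let x = num_zeros n s in
     if s i = 0
     then b * ((real n - real k) / real x) * (g a b (n - 1) k (x - 1) / g a b n k x)
     else (1 - b) * ((real n - real k) / (real n - real x)) * (g a b (n - 1) k x / g a b n k x))"

definition R :: "nat \<Rightarrow> nat \<Rightarrow> real \<Rightarrow> real \<Rightarrow> (nat \<Rightarrow> real) \<Rightarrow> (nat \<Rightarrow> real)
    \<Rightarrow> (nat \<Rightarrow> nat) \<Rightarrow> nat \<Rightarrow> real" where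
  "R n k a b c d s i = c i - (c i + d i) * \<alpha> n k a b s i"

definition selects_best :: "nat \<Rightarrow> nat \<Rightarrow> (nat \<Rightarrow> real) \<Rightarrow> nat set \<Rightarrow> bool" where
  "selects_best n m r I \<longleftrightarrow>
    (let P = {i \<in> {1..n}. r i > 0} in
     if card P \<le> m then I = P
     else I \<subseteq> {1..n} \<and> card I = m \<and> (\<forall>i\<in>I. \<forall>j\<in>{1..n} - I. r j \<le> r i))"

end

theory Submission
  imports Defs
begin

text \<open>
  Only the test results are observed, so the expected reward splits into one contribution for each
  \<open>s\<close>, and these can be maximized separately. The contribution of \<open>s\<close> is
  \<open>P(S = s)\<close> times the sum, over the tagged boxes, of the posterior mean reward
  \<open>c\<^sub>i P(T\<^sub>i = 1 | S = s) - d\<^sub>i P(T\<^sub>i = 0 | S = s)\<close>. Two facts remain.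

  The posterior mean reward is \<open>R\<^sub>i(s)\<close>, that is, \<open>P(T\<^sub>i = 0 | S = s) = \<alpha>\<^sub>i(s)\<close>. By Bayes'
  rule with a uniform prior, this probability is the quotient of two sums of the likelihood
  \<open>P(S = s | T = \<gamma>)\<close>: over the placements \<open>\<gamma>\<close> that leave box \<open>i\<close> empty, and over all
  placements. By symmetry, the sum over all placements depends on \<open>s\<close> only through its number \<open>x\<close>
  of zeros: it is the average over all vectors with \<open>x\<close> zeros, which is \<open>C(n, k) g\<^sub>n\<^sub>,\<^sub>k(x) / C(n, x)\<close>
  (lemma \<open>sum_prod_test_prob\<close>). When box \<open>i\<close> is empty, its test contributes a factor \<open>b\<close> or
  \<open>1 - b\<close>, and the remaining sum is the same sum for \<open>n - 1\<close> boxes. The quotient then simplifies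
  to \<open>\<alpha>\<^sub>i(s)\<close> (lemma \<open>sum_likelihood_empty_box_eq_\<alpha>\<close>).

  A set of at most \<open>m\<close> boxes with largest sum of \<open>R\<^sub>i(s)\<close> consists of the positive values, or
  of the \<open>m\<close> largest ones if there are more than \<open>m\<close> positive values (lemma
  \<open>selects_best_maximizes_sum\<close>). A vector \<open>s\<close> with \<open>g\<^sub>n\<^sub>,\<^sub>k(M(s)) = 0\<close> has probability \<open>0\<close>,
  so it contributes nothing to the expectation.
\<close>

section \<open>Maximizing a sum over a set of bounded size\<close>

text \<open>
  A selection of the best boxes has a threshold \<open>t \<ge> 0\<close>: values in \<open>I\<close> are at least \<open>t\<close> and
  values outside are at most \<open>t\<close>. A competitor \<open>J\<close> replaces \<open>I - J\<close> by \<open>J - I\<close>. If \<open>t > 0\<close>,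
  then \<open>J - I\<close> is not larger than \<open>I - J\<close>, so this exchange gains nothing; if \<open>t = 0\<close>, the sizes do
  not matter, because the values gained are not positive and those lost are not negative.
\<close>

lemma selects_best_maximizes_sum:
  fixes r :: "nat \<Rightarrow> real"
  assumes best: "selects_best n m r I" and J: "J \<subseteq> {1..n}" "card J \<le> m"
  shows "sum r J \<le> sum r I"
proof -
  define P where "P = {i \<in> {1..n}. r i > 0}"
  have I: "I \<subseteq> {1..n}"
    using best unfolding selects_best_def Let_def by (auto split: if_splits)
  then have fin: "finite I" "finite J"
    using J finite_subset by blast+
  obtain t where t: "t \<ge> 0" "\<And>i. i \<in> I \<Longrightarrow> t \<le> r i" "\<And>j. j \<in> {1..n} - I \<Longrightarrow> r j \<le> t"
    and full: "t = 0 \<or> card J \<le> card I"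
  proof (cases "card P \<le> m")
    case True
    then have "I = P"
      using best unfolding selects_best_def Let_def P_def by simp
    then show ?thesis
      by (intro that[of 0]) (auto simp: P_def not_less)
  next
    case False
    then have m: "card I = m" and le: "\<And>i j. i \<in> I \<Longrightarrow> j \<in> {1..n} - I \<Longrightarrow> r j \<le> r i"
      using best unfolding selects_best_def Let_def P_def by auto
    have "\<not> P \<subseteq> I"
      using card_mono[OF fin(1), of P] False m by auto
    then obtain p where p: "p \<in> {1..n} - I" "r p > 0"
      by (auto simp: P_def)
    \<comment> \<open>the best value left out; it is positive because more than \<open>m\<close> values are\<close>
    define t where "t = Max (r ` ({1..n} - I))"
    have upper: "r j \<le> t" if "j \<in> {1..n} - I" for j
      unfolding t_def using that by (intro Max_ge) auto
    have "t \<in> r ` ({1..n} - I)"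
      unfolding t_def using p by (intro Max_in) auto
    then have "t \<le> r i" if "i \<in> I" for i
      using le that by auto
    moreover have "t \<ge> 0"
      using upper[OF p(1)] p(2) by simp
    ultimately show ?thesis
      using upper m J(2) by (intro that[of t]) auto
  qed
  \<comment> \<open>cancel the common part \<open>J \<inter> I\<close> from both sets\<close>
  have "card J \<le> card I \<Longrightarrow> card (J - I) \<le> card (I - J)"
    using card_Un_disjoint[of "J - I" "J \<inter> I"] card_Un_disjoint[of "I - J" "J \<inter> I"] fin
    by (metis Diff_disjoint Int_Diff Int_commute Un_Diff_Int add_le_cancel_right finite_Diff
        finite_Int inf_left_commute inf_bot_right)
  then have "t * card (J - I) \<le> t * card (I - J)"
    using full t(1) by (auto intro: mult_left_mono)
  moreover have "sum r (J - I) \<le> t * card (J - I)"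
    using sum_bounded_above[of "J - I" r t] t(3) J(1) by (force simp: mult.commute)
  moreover have "t * card (I - J) \<le> sum r (I - J)"
    using sum_bounded_below[of "I - J" t r] t(2) by (auto simp: mult.commute)
  moreover have "sum r J = sum r (J - I) + sum r (J \<inter> I)" "sum r I = sum r (I - J) + sum r (J \<inter> I)"
    using sum.Int_Diff[OF fin(2), of r I] sum.Int_Diff[OF fin(1), of r J]
    by (simp_all add: Int_commute)
  ultimately show ?thesis
    by linarith
qed

section \<open>Likelihoods summed over the placements\<close>

text \<open>
  Placements and test results are treated here as sets, the set \<open>G\<close> of boxes with an object and the
  set \<open>Z\<close> of boxes with a negative test, so that counting them is counting subsets and removing a
  box is removing an element.
\<close>

definition test_prob :: "real \<Rightarrow> real \<Rightarrow> bool \<Rightarrow> bool \<Rightarrow> real" where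
  "test_prob a b object negative =
     (if object then if negative then 1 - a else a else if negative then b else 1 - b)"

text \<open>
  The index \<open>j\<close> is the number of objects with a negative test. Cutting the convolution off at
  \<open>min k x\<close> drops only zero terms and keeps the subtractions \<open>k - j\<close> and \<open>x - j\<close> from truncating.
\<close>

lemma g_eq_sum:
  fixes a b :: real
  assumes "a \<in> {0..1}" "b \<in> {0..1}"
  shows "g a b N k x = (\<Sum>j\<le>min k x. (k choose j) * (1 - a) ^ j * a ^ (k - j) *
           ((N - k choose (x - j)) * b ^ (x - j) * (1 - b) ^ (N - k - (x - j))))"
proof -
  let ?p = "pair_pmf (binomial_pmf k (1 - a)) (binomial_pmf (N - k) b)"
  have preimage: "(\<lambda>(i, j). i + j) -` {x} = (\<lambda>j. (j, x - j)) ` {..x}"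
    by (auto simp: image_iff)
  have "g a b N k x = measure (measure_pmf ?p) ((\<lambda>j. (j, x - j)) ` {..x})"
    unfolding g_def pmf_map preimage ..
  also have "\<dots> = (\<Sum>j\<le>x. pmf ?p (j, x - j))"
    by (subst measure_measure_pmf_finite) (auto simp: sum.reindex inj_on_def)
  also have "\<dots> = (\<Sum>j\<le>x. (k choose j) * (1 - a) ^ j * a ^ (k - j) *
           ((N - k choose (x - j)) * b ^ (x - j) * (1 - b) ^ (N - k - (x - j))))"
    using assms by (simp add: pmf_pair)
  also have "\<dots> = (\<Sum>j\<le>min k x. (k choose j) * (1 - a) ^ j * a ^ (k - j) *
           ((N - k choose (x - j)) * b ^ (x - j) * (1 - b) ^ (N - k - (x - j))))"
    by (rule sum.mono_neutral_right) auto
  finally show ?thesis .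
qed

lemma card_subsets_with_trace:
  assumes "finite A" "Z \<subseteq> A" "j \<le> k"
  shows "card {G. G \<subseteq> A \<and> card G = k \<and> card (G \<inter> Z) = j} =
         (card Z choose j) * (card A - card Z choose (k - j))"
proof -
  have fin: "finite Z" "finite (A - Z)"
    using assms finite_subset by auto
  let ?P = "{U. U \<subseteq> Z \<and> card U = j} \<times> {V. V \<subseteq> A - Z \<and> card V = k - j}"
  have "bij_betw (\<lambda>G. (G \<inter> Z, G - Z)) {G. G \<subseteq> A \<and> card G = k \<and> card (G \<inter> Z) = j} ?P"
  proof (rule bij_betw_byWitness[where f' = "\<lambda>(U, V). U \<union> V"])
    show "(\<lambda>G. (G \<inter> Z, G - Z)) ` {G. G \<subseteq> A \<and> card G = k \<and> card (G \<inter> Z) = j} \<subseteq> ?P"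
    proof (clarsimp, intro conjI)
      fix G assume G: "G \<subseteq> A"
      then have "finite G" using assms(1) finite_subset by blast
      then show "card (G - Z) = card G - card (G \<inter> Z)"
        by (simp add: card_Diff_subset_Int)
      show "G - Z \<subseteq> A - Z" using G by auto
    qed
    show "(\<lambda>(U, V). U \<union> V) ` ?P \<subseteq> {G. G \<subseteq> A \<and> card G = k \<and> card (G \<inter> Z) = j}"
    proof (clarsimp, intro conjI)
      fix U V assume UV: "U \<subseteq> Z" "V \<subseteq> A - Z" "card V = k - card U" "j = card U"
      have *: "(U \<union> V) \<inter> Z = U" "U \<inter> V = {}" using UV by auto
      have "finite U" "finite V" using UV fin finite_subset by blast+
      then show "card (U \<union> V) = k"
        using * UV assms(3) by (simp add: card_Un_disjoint)
      show "card ((U \<union> V) \<inter> Z) = card U" using * by simp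
      show "U \<subseteq> A" "V \<subseteq> A" using UV assms by auto
    qed
  qed auto
  then show ?thesis
    using fin assms by (simp add: bij_betw_same_card card_cartesian_product n_subsets card_Diff_subset)
qed

text \<open>
  Both sides count the pairs of a \<open>k\<close>-subset and an \<open>x\<close>-subset of an \<open>n\<close>-set that meet in \<open>j\<close>
  elements. The proof chooses the intersection first and then the two remaining parts, one after the
  other in either order.
\<close>

lemma multinomial_swap:
  fixes n k x j :: nat
  assumes "j \<le> k" "j \<le> x" "k \<le> n" "x \<le> n"
  shows "(n choose k) * (k choose j) * (n - k choose (x - j)) =
         (n choose x) * (x choose j) * (n - x choose (k - j))"
proof -
  have pair: "(N choose p) * (N - p choose q) = (N choose q) * (N - q choose p)"
    if "p \<le> N" "q \<le> N" for N p q :: nat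
  proof (cases "p + q \<le> N")
    case True
    then show ?thesis
      using choose_mult[of p "p + q" N] choose_mult[of q "p + q" N]
        binomial_symmetric[of p "p + q"] by simp
  qed (use that in \<open>auto simp: binomial_eq_0\<close>)
  show ?thesis
    using choose_mult[of j k n] choose_mult[of j x n] pair[of "k - j" "n - j" "x - j"] assms
    by (simp add: mult.assoc)
qed

lemma prod_test_prob:
  assumes "finite A" "Z \<subseteq> A" "G \<subseteq> A"
  shows "(\<Prod>i\<in>A. test_prob a b (i \<in> G) (i \<in> Z)) =
    (1 - a) ^ card (G \<inter> Z) * a ^ (card G - card (G \<inter> Z)) * b ^ (card Z - card (G \<inter> Z)) *
    (1 - b) ^ (card A - card Z - (card G - card (G \<inter> Z)))"
proof -
  have fin: "finite G" "finite Z" using assms finite_subset by auto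
  let ?f = "\<lambda>i. test_prob a b (i \<in> G) (i \<in> Z)"
  have "prod ?f A = prod ?f G * prod ?f (A - G)"
    using prod.subset_diff[OF assms(3,1), of ?f] by (simp only: mult.commute)
  also have "prod ?f G = prod ?f (G \<inter> Z) * prod ?f (G - Z)"
    using prod.Int_Diff[OF fin(1)] .
  also have "prod ?f (A - G) = prod ?f ((A - G) \<inter> Z) * prod ?f (A - G - Z)"
    using prod.Int_Diff[OF finite_Diff[OF assms(1)]] .
  also have "prod ?f (G \<inter> Z) = (1 - a) ^ card (G \<inter> Z)"
    by (simp add: test_prob_def)
  also have "prod ?f (G - Z) = a ^ card (G - Z)"
    by (simp add: test_prob_def)
  also have "prod ?f ((A - G) \<inter> Z) = b ^ card ((A - G) \<inter> Z)"
    by (simp add: test_prob_def)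
  also have "prod ?f (A - G - Z) = (1 - b) ^ card (A - G - Z)"
    by (simp add: test_prob_def)
  also have "card (G - Z) = card G - card (G \<inter> Z)"
    using fin by (simp add: card_Diff_subset_Int)
  also have "(A - G) \<inter> Z = Z - G" using assms by auto
  also have "card (Z - G) = card Z - card (G \<inter> Z)"
    using fin by (simp add: card_Diff_subset_Int Int_commute)
  also have "A - G - Z = (A - Z) - (G - Z)" by auto
  also have "card \<dots> = card A - card Z - (card G - card (G \<inter> Z))"
    using fin assms by (subst card_Diff_subset) (auto simp: card_Diff_subset card_Diff_subset_Int)
  finally show ?thesis by (simp add: mult_ac)
qed

text \<open>
  Let \<open>n = card A\<close> and \<open>x = card Z\<close>. For \<open>k \<le> n\<close>, both sides are \<open>P(Z | G)\<close>
  summed over all pairs of a \<open>k\<close>-subset \<open>G\<close> and an \<open>x\<close>-subset \<open>Z\<close> of \<open>A\<close>. On the left the sum over \<open>G\<close> is the same for each of the \<open>C(n, x)\<close> sets \<open>Z\<close>; on the right the sum over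
  \<open>Z\<close> is \<open>g\<^sub>n\<^sub>,\<^sub>k(x)\<close> for each of the \<open>C(n, k)\<close> sets \<open>G\<close>. The proof compares the parts with
  \<open>card (G \<inter> Z) = j\<close>, on which the probability is constant. The equation is multiplied out so that
  it also holds, as \<open>0 = 0\<close>, for \<open>k > n\<close>: after a box is removed this happens if every
  box contains an object.
\<close>

lemma sum_prod_test_prob:
  fixes a b :: real
  assumes A: "finite A" "Z \<subseteq> A" and ab: "a \<in> {0..1}" "b \<in> {0..1}"
  shows "(card A choose card Z) *
      (\<Sum>G | G \<subseteq> A \<and> card G = k. \<Prod>i\<in>A. test_prob a b (i \<in> G) (i \<in> Z)) =
    (card A choose k) * g a b (card A) k (card Z)"
proof (cases "k \<le> card A")
  case False
  then have "{G. G \<subseteq> A \<and> card G = k} = {}"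
    using card_mono[OF A(1)] by auto
  then show ?thesis
    using False by (simp only: sum.empty) (simp add: binomial_eq_0)
next
  case True
  define n x where "n = card A" and "x = card Z"
  have x: "x \<le> n" and k: "k \<le> n"
    unfolding n_def x_def using A True by (auto intro: card_mono)
  let ?w = "\<lambda>j. (1 - a) ^ j * a ^ (k - j) * b ^ (x - j) * (1 - b) ^ (n - x - (k - j))"
  have finG: "finite {G. G \<subseteq> A \<and> card G = k}"
    using A(1) by simp
  have finZ: "finite Z" using A finite_subset by blast
  have "(\<Sum>G | G \<subseteq> A \<and> card G = k. \<Prod>i\<in>A. test_prob a b (i \<in> G) (i \<in> Z)) =
        (\<Sum>G | G \<subseteq> A \<and> card G = k. ?w (card (G \<inter> Z)))"
    using A by (intro sum.cong) (auto simp: prod_test_prob n_def x_def)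
  also have "\<dots> = (\<Sum>j\<le>min k x. \<Sum>G | G \<in> {G. G \<subseteq> A \<and> card G = k} \<and> card (G \<inter> Z) = j. ?w (card (G \<inter> Z)))"
  proof (rule sum.group[symmetric, OF finG])
    have "card (G \<inter> Z) \<le> min (card G) x" if "G \<subseteq> A" for G
      using that A finZ finite_subset unfolding x_def by (auto intro!: card_mono)
    then show "(\<lambda>G. card (G \<inter> Z)) ` {G. G \<subseteq> A \<and> card G = k} \<subseteq> {..min k x}"
      by fastforce
  qed simp
  also have "\<dots> = (\<Sum>j\<le>min k x. (x choose j) * (n - x choose (k - j)) * ?w j)"
  proof (intro sum.cong refl)
    fix j assume "j \<in> {..min k x}"
    then have "card {G. G \<in> {G. G \<subseteq> A \<and> card G = k} \<and> card (G \<inter> Z) = j} =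
        (x choose j) * (n - x choose (k - j))"
      using card_subsets_with_trace[OF A, of j k] by (simp add: n_def x_def conj_assoc)
    moreover have "(\<Sum>G | G \<in> {G. G \<subseteq> A \<and> card G = k} \<and> card (G \<inter> Z) = j. ?w (card (G \<inter> Z))) =
        (\<Sum>G | G \<in> {G. G \<subseteq> A \<and> card G = k} \<and> card (G \<inter> Z) = j. ?w j)"
      by (rule sum.cong) auto
    ultimately show "(\<Sum>G | G \<in> {G. G \<subseteq> A \<and> card G = k} \<and> card (G \<inter> Z) = j. ?w (card (G \<inter> Z))) =
        (x choose j) * (n - x choose (k - j)) * ?w j"
      by simp
  qed
  finally have weights: "(\<Sum>G | G \<subseteq> A \<and> card G = k. \<Prod>i\<in>A. test_prob a b (i \<in> G) (i \<in> Z)) =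
      (\<Sum>j\<le>min k x. (x choose j) * (n - x choose (k - j)) * ?w j)" .
  have "(n choose x) * ((x choose j) * (n - x choose (k - j)) * ?w j) =
      (n choose k) * ((k choose j) * (1 - a) ^ j * a ^ (k - j) *
        ((n - k choose (x - j)) * b ^ (x - j) * (1 - b) ^ (n - k - (x - j))))"
    if "j \<le> min k x" for j
  proof -
    \<comment> \<open>equal even if truncated: both vanish when \<open>n + j \<le> k + x\<close>\<close>
    have e: "n - k - (x - j) = n - x - (k - j)" using that x k by auto
    have "real ((n choose k) * (k choose j) * (n - k choose (x - j))) =
          real ((n choose x) * (x choose j) * (n - x choose (k - j)))"
      using multinomial_swap[of j k x n] that x k by simp
    then show ?thesis
      unfolding e of_nat_mult by (simp add: algebra_simps)
  qed
  then show ?thesis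
    unfolding weights g_eq_sum[OF ab] n_def[symmetric] x_def[symmetric] sum_distrib_left
    by (intro sum.cong) auto
qed


section \<open>The posterior probability of an empty box\<close>

definition likelihood :: "nat \<Rightarrow> real \<Rightarrow> real \<Rightarrow> (nat \<Rightarrow> nat) \<Rightarrow> (nat \<Rightarrow> nat) \<Rightarrow> real" where
  "likelihood n a b \<gamma> s = (\<Prod>i=1..n. test_prob a b (\<gamma> i = 1) (s i = 0))"

lemma likelihood_nonneg:
  "a \<in> {0..1} \<Longrightarrow> b \<in> {0..1} \<Longrightarrow> likelihood n a b \<gamma> s \<ge> 0"
  unfolding likelihood_def test_prob_def by (intro prod_nonneg) auto

lemma bin_vecsD: "s \<in> bin_vecs n \<Longrightarrow> i \<in> {1..n} \<Longrightarrow> s i = 0 \<or> s i = 1"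
  unfolding bin_vecs_def by (auto dest!: PiE_mem)

lemma finite_bin_vecs [simp]: "finite (bin_vecs n)"
  unfolding bin_vecs_def by (intro finite_PiE) auto

lemma finite_placements [simp]: "finite (placements n k)"
  unfolding placements_def by simp

lemma sum_bin_vec: "s \<in> bin_vecs n \<Longrightarrow> (\<Sum>j=1..n. s j) = card {i \<in> {1..n}. s i = 1}"
proof -
  assume s: "s \<in> bin_vecs n"
  have "(\<Sum>j=1..n. s j) = (\<Sum>j=1..n. if s j = 1 then 1 else 0)"
    using bin_vecsD[OF s] by (intro sum.cong) auto
  also have "\<dots> = card {i \<in> {1..n}. s i = 1}"
    by (subst sum.If_cases) (auto simp: Int_def)
  finally show ?thesis .
qed

lemma num_zeros_eq_card: "s \<in> bin_vecs n \<Longrightarrow> num_zeros n s = card {i \<in> {1..n}. s i = 0}"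
proof -
  assume s: "s \<in> bin_vecs n"
  have "num_zeros n s = (\<Sum>j=1..n. if s j = 0 then 1 else 0)"
    unfolding num_zeros_def using bin_vecsD[OF s] by (intro sum.cong) auto
  also have "\<dots> = card {i \<in> {1..n}. s i = 0}"
    by (subst sum.If_cases) (auto simp: Int_def)
  finally show ?thesis .
qed

lemma num_zeros_le: "s \<in> bin_vecs n \<Longrightarrow> num_zeros n s \<le> n"
  using card_mono[of "{1..n}" "{i \<in> {1..n}. s i = 0}"] num_zeros_eq_card[of s n] by fastforce

lemma bij_betw_placements:
  "bij_betw (\<lambda>\<gamma>. {i \<in> {1..n}. \<gamma> i = 1}) (placements n k) {G. G \<subseteq> {1..n} \<and> card G = k}"
proof (rule bij_betw_byWitness[where f' = "\<lambda>G. \<lambda>i\<in>{1..n}. of_bool (i \<in> G)"])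
  show "\<forall>\<gamma>\<in>placements n k. (\<lambda>i\<in>{1..n}. of_bool (i \<in> {i \<in> {1..n}. \<gamma> i = 1})) = \<gamma>"
  proof
    fix \<gamma> assume "\<gamma> \<in> placements n k"
    then have \<gamma>: "\<gamma> \<in> bin_vecs n" by (simp add: placements_def)
    show "(\<lambda>i\<in>{1..n}. of_bool (i \<in> {i \<in> {1..n}. \<gamma> i = 1})) = \<gamma>"
    proof
      fix i
      show "(\<lambda>i\<in>{1..n}. of_bool (i \<in> {i \<in> {1..n}. \<gamma> i = 1})) i = \<gamma> i"
        using bin_vecsD[OF \<gamma>, of i] PiE_arb[OF \<gamma>[unfolded bin_vecs_def], of i]
        by (cases "i \<in> {1..n}") fastforce+
    qed
  qed
  show "(\<lambda>\<gamma>. {i \<in> {1..n}. \<gamma> i = 1}) ` placements n k \<subseteq> {G. G \<subseteq> {1..n} \<and> card G = k}"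
  proof (rule image_subsetI)
    fix \<gamma> assume "\<gamma> \<in> placements n k"
    then have "card {i \<in> {1..n}. \<gamma> i = 1} = k"
      using sum_bin_vec[of \<gamma> n] by (simp add: placements_def)
    then show "{i \<in> {1..n}. \<gamma> i = 1} \<in> {G. G \<subseteq> {1..n} \<and> card G = k}"
      by blast
  qed
  show "(\<lambda>G. \<lambda>i\<in>{1..n}. of_bool (i \<in> G)) ` {G. G \<subseteq> {1..n} \<and> card G = k} \<subseteq> placements n k"
  proof safe
    fix G assume G: "G \<subseteq> {1..n}" "k = card G"
    have v: "(\<lambda>i\<in>{1..n}. of_bool (i \<in> G)) \<in> bin_vecs n"
      by (auto simp: bin_vecs_def)
    have "{i \<in> {1..n}. (\<lambda>i\<in>{1..n}. of_bool (i \<in> G) :: nat) i = 1} = G"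
      using G by auto
    then show "(\<lambda>i\<in>{1..n}. of_bool (i \<in> G)) \<in> placements n (card G)"
      unfolding placements_def using v sum_bin_vec[OF v] by simp
  qed
qed auto

text \<open>
  The predicate \<open>Q\<close> makes the passage from vectors to sets available both for all placements and for
  those that leave a given box empty.
\<close>

lemma sum_likelihood_reindex:
  "(\<Sum>\<gamma> | \<gamma> \<in> placements n k \<and> Q {i \<in> {1..n}. \<gamma> i = 1}. likelihood n a b \<gamma> s) =
   (\<Sum>G | G \<subseteq> {1..n} \<and> card G = k \<and> Q G.
      \<Prod>i=1..n. test_prob a b (i \<in> G) (i \<in> {i \<in> {1..n}. s i = 0}))"
proof -
  let ?h = "\<lambda>\<gamma> :: nat \<Rightarrow> nat. {i \<in> {1..n}. \<gamma> i = 1}"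
  have bij: "bij_betw ?h {\<gamma>. \<gamma> \<in> placements n k \<and> Q (?h \<gamma>)} {G. G \<subseteq> {1..n} \<and> card G = k \<and> Q G}"
    using bij_betw_Collect[OF bij_betw_placements[of n k], of Q] by (simp add: conj_assoc)
  show ?thesis
    unfolding likelihood_def
    by (subst sum.reindex_bij_betw[OF bij, symmetric]) (intro sum.cong prod.cong; simp)
qed

lemma sum_likelihood:
  assumes "s \<in> bin_vecs n" "a \<in> {0..1}" "b \<in> {0..1}"
  shows "(n choose num_zeros n s) * (\<Sum>\<gamma>\<in>placements n k. likelihood n a b \<gamma> s) =
         (n choose k) * g a b n k (num_zeros n s)"
  using sum_likelihood_reindex[where Q = "\<lambda>_. True" and n = n and k = k and s = s and a = a and b = b]
    sum_prod_test_prob[of "{1..n}" "{i \<in> {1..n}. s i = 0}" a b k] num_zeros_eq_card[OF assms(1)] assms(2,3)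
  by (simp add: subset_eq)

lemma sum_likelihood_eq_0:
  assumes "s \<in> bin_vecs n" "a \<in> {0..1}" "b \<in> {0..1}" "g a b n k (num_zeros n s) = 0"
  shows "(\<Sum>\<gamma>\<in>placements n k. likelihood n a b \<gamma> s) = 0"
  using sum_likelihood[OF assms(1-3), of k] num_zeros_le[OF assms(1)] assms(4) by simp

lemma sum_likelihood_empty_box:
  assumes "i \<in> {1..n}"
  shows "(\<Sum>\<gamma> | \<gamma> \<in> placements n k \<and> \<gamma> i = 0. likelihood n a b \<gamma> s) =
    test_prob a b False (s i = 0) *
    (\<Sum>G | G \<subseteq> {1..n} - {i} \<and> card G = k.
      \<Prod>j\<in>{1..n} - {i}. test_prob a b (j \<in> G) (j \<in> {j \<in> {1..n} - {i}. s j = 0}))"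
proof -
  have "{\<gamma>. \<gamma> \<in> placements n k \<and> \<gamma> i = 0} =
        {\<gamma>. \<gamma> \<in> placements n k \<and> i \<notin> {i \<in> {1..n}. \<gamma> i = 1}}"
    using assms bin_vecsD[of _ n i] by (auto simp: placements_def)
  then have "(\<Sum>\<gamma> | \<gamma> \<in> placements n k \<and> \<gamma> i = 0. likelihood n a b \<gamma> s) =
    (\<Sum>G | G \<subseteq> {1..n} \<and> card G = k \<and> i \<notin> G.
      \<Prod>j=1..n. test_prob a b (j \<in> G) (j \<in> {j \<in> {1..n}. s j = 0}))"
    using sum_likelihood_reindex[where Q = "\<lambda>G. i \<notin> G"] by simp
  also have "\<dots> = (\<Sum>G | G \<subseteq> {1..n} - {i} \<and> card G = k. test_prob a b False (s i = 0) *
      (\<Prod>j\<in>{1..n} - {i}. test_prob a b (j \<in> G) (j \<in> {j \<in> {1..n} - {i}. s j = 0})))"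
  proof (rule sum.cong)
    fix G assume "G \<in> {G. G \<subseteq> {1..n} - {i} \<and> card G = k}"
    then have "i \<notin> G" by auto
    then show "(\<Prod>j=1..n. test_prob a b (j \<in> G) (j \<in> {j \<in> {1..n}. s j = 0})) =
      test_prob a b False (s i = 0) *
      (\<Prod>j\<in>{1..n} - {i}. test_prob a b (j \<in> G) (j \<in> {j \<in> {1..n} - {i}. s j = 0}))"
      using assms by (subst prod.remove[of _ i]) (auto intro!: prod.cong)
  qed auto
  finally show ?thesis
    by (simp add: sum_distrib_left)
qed

text \<open>
  Bayes' rule: the uniform prior cancels from the quotient of the two sums. With
  \<open>n C(n-1, k) = (n-k) C(n, k)\<close>, \<open>n C(n-1, x-1) = x C(n, x)\<close> and \<open>n C(n-1, x) = (n-x) C(n, x)\<close>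
  the binomial coefficients of the two sums combine to the factors \<open>(n-k)/x\<close> and \<open>(n-k)/(n-x)\<close>.
\<close>

lemma sum_likelihood_empty_box_eq_\<alpha>:
  assumes s: "s \<in> bin_vecs n" and i: "i \<in> {1..n}" and k: "k \<le> n"
    and ab: "a \<in> {0..1}" "b \<in> {0..1}"
    and pos: "g a b n k (num_zeros n s) > 0"
  shows "(\<Sum>\<gamma> | \<gamma> \<in> placements n k \<and> \<gamma> i = 0. likelihood n a b \<gamma> s) =
         \<alpha> n k a b s i * (\<Sum>\<gamma>\<in>placements n k. likelihood n a b \<gamma> s)"
proof -
  define x where "x = num_zeros n s"
  define Z where "Z = {j \<in> {1..n}. s j = 0}"
  define G0 where "G0 = g a b n k x"
  define w where "w = (\<Sum>\<gamma>\<in>placements n k. likelihood n a b \<gamma> s)"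
  define y where "y = (\<Sum>G | G \<subseteq> {1..n} - {i} \<and> card G = k.
      \<Prod>j\<in>{1..n} - {i}. test_prob a b (j \<in> G) (j \<in> {j \<in> {1..n} - {i}. s j = 0}))"
  have xZ: "x = card Z"
    unfolding x_def Z_def using num_zeros_eq_card[OF s] .
  have xn: "x \<le> n"
    unfolding x_def by (rule num_zeros_le[OF s])
  have G0: "G0 > 0" using pos unfolding G0_def x_def .
  have w: "(n choose x) * w = (n choose k) * G0"
    using sum_likelihood[OF s ab] unfolding w_def G0_def x_def .
  have Zi: "{j \<in> {1..n} - {i}. s j = 0} = Z - {i}"
    unfolding Z_def by auto
  have y: "(n - 1 choose card (Z - {i})) * y = (n - 1 choose k) * g a b (n - 1) k (card (Z - {i}))"
  proof -
    have "Z - {i} \<subseteq> {1..n} - {i}" by (auto simp: Z_def)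
    from sum_prod_test_prob[OF _ this ab, of k] i show ?thesis
      unfolding y_def Zi by simp
  qed
  have absorb: "real n * (n - 1 choose k) = (real n - k) * (n choose k)" if "k \<le> n" for k
    using binomial_absorb_comp[of n k] that by (metis of_nat_diff of_nat_mult)
  have lhs: "(\<Sum>\<gamma> | \<gamma> \<in> placements n k \<and> \<gamma> i = 0. likelihood n a b \<gamma> s) =
      test_prob a b False (s i = 0) * y"
    unfolding y_def by (rule sum_likelihood_empty_box[OF i])
  define C where "C = real (n choose x)"
  have C: "C > 0" unfolding C_def using xn by simp
  \<comment> \<open>with \<open>u = x\<close> for a negative and \<open>u = n - x\<close> for a positive test of box \<open>i\<close>\<close>
  have cancel: "u * G0 * y = (real n - k) * h * w"
    if "u * C * y = real n * (n - 1 choose k) * h" for u h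
  proof -
    have "C * (u * G0 * y) = G0 * (u * C * y)"
      by (simp add: mult_ac)
    also have "\<dots> = (real n - k) * h * ((n choose k) * G0)"
      unfolding that absorb[OF k] by (simp add: mult_ac)
    also have "\<dots> = C * ((real n - k) * h * w)"
      unfolding w[symmetric] C_def by (simp add: mult_ac)
    finally show ?thesis using C by simp
  qed
  show ?thesis
  proof (cases "s i = 0")
    case True
    then have iZ: "i \<in> Z" using i by (simp add: Z_def)
    then have x: "x > 0" "card (Z - {i}) = x - 1"
      unfolding xZ by (auto simp: card_gt_0_iff Z_def)
    have "real n * (n - 1 choose (x - 1)) = x * C"
      unfolding C_def using times_binomial_minus1_eq[OF x(1), of n] by (metis of_nat_mult)
    then have "x * C * y = real n * ((n - 1 choose (x - 1)) * y)"
      by simp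
    then have "x * G0 * y = (real n - k) * g a b (n - 1) k (x - 1) * w"
      using y unfolding x(2) by (intro cancel) (simp only: mult.assoc)
    then have "y = (real n - k) * g a b (n - 1) k (x - 1) * w / (x * G0)"
      using x(1) G0 by (simp add: eq_divide_eq mult.commute)
    then show ?thesis
      using True unfolding lhs w_def[symmetric] \<alpha>_def Let_def x_def[symmetric] G0_def[symmetric]
      by (simp add: test_prob_def)
  next
    case False
    then have iZ: "i \<notin> Z" by (simp add: Z_def)
    then have "Z \<subseteq> {1..n} - {i}" by (auto simp: Z_def)
    then have "card Z \<le> card ({1..n} - {i})" by (intro card_mono) auto
    then have x: "x < n" "card (Z - {i}) = x"
      unfolding xZ using i iZ by auto
    have "(real n - x) * C * y = real n * ((n - 1 choose x) * y)"
      using absorb[OF xn] unfolding C_def by simp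
    then have "(real n - x) * G0 * y = (real n - k) * g a b (n - 1) k x * w"
      using y unfolding x(2) by (intro cancel) (simp only: mult.assoc)
    then have "y = (real n - k) * g a b (n - 1) k x * w / ((real n - x) * G0)"
      using x(1) G0 by (simp add: eq_divide_eq mult.commute)
    then show ?thesis
      using False unfolding lhs w_def[symmetric] \<alpha>_def Let_def x_def[symmetric] G0_def[symmetric]
      by (simp add: test_prob_def)
  qed
qed

section \<open>The expected reward in terms of likelihoods\<close>

context symmetric_test_and_find
begin

lemma T_mem: "\<omega> \<in> space M \<Longrightarrow> T \<omega> \<in> placements n k"
  using measurable_space[OF T_measurable] by simp

lemma S_mem: "\<omega> \<in> space M \<Longrightarrow> S \<omega> \<in> bin_vecs n"
  using measurable_space[OF S_measurable] by simp

lemma T_event [measurable]: "{\<omega> \<in> space M. T \<omega> = \<gamma>} \<in> events"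
proof -
  have "{\<omega> \<in> space M. T \<omega> = \<gamma>} = T -` ({\<gamma>} \<inter> placements n k) \<inter> space M"
    using T_mem by auto
  then show ?thesis
    using measurable_sets[OF T_measurable, of "{\<gamma>} \<inter> placements n k"] by simp
qed

lemma S_event [measurable]: "{\<omega> \<in> space M. P (S \<omega>)} \<in> events"
proof -
  have "{\<omega> \<in> space M. P (S \<omega>)} = S -` (Collect P \<inter> bin_vecs n) \<inter> space M"
    using S_mem by auto
  then show ?thesis
    using measurable_sets[OF S_measurable, of "Collect P \<inter> bin_vecs n"] by simp
qed

lemma joint_event: "{\<omega> \<in> space M. T \<omega> = \<gamma> \<and> S \<omega> = s} \<in> events"
proof -
  have "{\<omega> \<in> space M. T \<omega> = \<gamma> \<and> S \<omega> = s} = {\<omega> \<in> space M. T \<omega> = \<gamma>} \<inter> {\<omega> \<in> space M. S \<omega> = s}"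
    by auto
  then show ?thesis by simp
qed

lemma prob_placement:
  assumes "\<gamma> \<in> placements n k"
  shows "prob {\<omega> \<in> space M. T \<omega> = \<gamma>} = 1 / card (placements n k)"
proof -
  have "prob {\<omega> \<in> space M. T \<omega> = \<gamma>} = measure (distr M (count_space (placements n k)) T) {\<gamma>}"
    using assms by (subst measure_distr[OF T_measurable]) (auto intro!: arg_cong[where f = prob])
  also have "\<dots> = 1 / card (placements n k)"
    unfolding T_uniform using assms
    by (simp add: measure_uniform_count_measure)
  finally show ?thesis .
qed

lemma prob_placement_pos:
  assumes "\<gamma> \<in> placements n k"
  shows "prob {\<omega> \<in> space M. T \<omega> = \<gamma>} > 0"
  using assms by (auto simp: prob_placement card_gt_0_iff)

text \<open>
  The model prescribes one conditional probability of each test, \<open>a\<close> or \<open>b\<close>; the other is its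
  complement because results are binary. Conditional independence then gives the product.
\<close>

lemma prob_joint:
  assumes \<gamma>: "\<gamma> \<in> placements n k" and s: "s \<in> bin_vecs n" and n: "n \<ge> 1"
  shows "prob {\<omega> \<in> space M. T \<omega> = \<gamma> \<and> S \<omega> = s} = likelihood n a b \<gamma> s / card (placements n k)"
proof -
  define E where "E = {\<omega> \<in> space M. T \<omega> = \<gamma>}"
  define U where "U = uniform_measure M E"
  have E: "E \<in> events" "prob E > 0"
    using prob_placement_pos[OF \<gamma>] unfolding E_def by auto
  then have emE: "emeasure M E \<noteq> 0" "emeasure M E \<noteq> \<infinity>"
    by (auto simp: emeasure_eq_measure)
  interpret U: prob_space U
    unfolding U_def using emE by (rule prob_space_uniform_measure)
  have sets_U: "sets U = sets M" and space_U: "space U = space M"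
    unfolding U_def by auto
  have U: "U.prob A = prob (A \<inter> E) / prob E" if "A \<in> events" for A
    unfolding U_def using measure_uniform_measure[OF emE that] by (simp add: Int_commute)
  have single: "U.prob {\<omega> \<in> space M. S \<omega> i = s i} = test_prob a b (\<gamma> i = 1) (s i = 0)"
    if i: "i \<in> {1..n}" for i
  proof -
    have cond: "U.prob {\<omega> \<in> space M. S \<omega> i = v} = \<P>(\<omega> in M. S \<omega> i = v \<bar> T \<omega> = \<gamma>)" for v
      using U[of "{\<omega> \<in> space M. S \<omega> i = v}"] S_event[of "\<lambda>s. s i = v"]
      unfolding cond_prob_def E_def
      by (auto intro!: arg_cong2[where f = "(/)"] arg_cong[where f = prob])
    have compl: "U.prob {\<omega> \<in> space M. S \<omega> i = 1} + U.prob {\<omega> \<in> space M. S \<omega> i = 0} = 1"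
    proof -
      have "{\<omega> \<in> space M. S \<omega> i = 1} \<union> {\<omega> \<in> space M. S \<omega> i = 0} = space U"
        using S_mem bin_vecsD[OF _ i] space_U by blast
      moreover have "U.prob ({\<omega> \<in> space M. S \<omega> i = 1} \<union> {\<omega> \<in> space M. S \<omega> i = 0}) =
          U.prob {\<omega> \<in> space M. S \<omega> i = 1} + U.prob {\<omega> \<in> space M. S \<omega> i = 0}"
        using S_event[of "\<lambda>s. s i = 1"] S_event[of "\<lambda>s. s i = 0"]
        by (intro U.finite_measure_Union) (auto simp: sets_U)
      ultimately show ?thesis using U.prob_space by simp
    qed
    have "\<gamma> i = 0 \<or> \<gamma> i = 1" "s i = 0 \<or> s i = 1"
      using bin_vecsD[OF _ i] s \<gamma> by (auto simp: placements_def)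
    then show ?thesis
      using compl S_true_positive[OF \<gamma> i] S_true_negative[OF \<gamma> i]
      unfolding cond test_prob_def by auto
  qed
  have ext: "t = s" if "t \<in> bin_vecs n" "\<And>i. i \<in> {1..n} \<Longrightarrow> t i = s i" for t
    using PiE_ext[of t "{1..n}" _ s] that s unfolding bin_vecs_def by blast
  have inter: "(\<Inter>i\<in>{1..n}. (\<lambda>\<omega>. S \<omega> i) -` {s i} \<inter> space U) = {\<omega> \<in> space M. S \<omega> = s}"
    using n S_mem ext unfolding space_U by auto
  have "U.prob (\<Inter>i\<in>{1..n}. (\<lambda>\<omega>. S \<omega> i) -` {s i} \<inter> space U) =
      (\<Prod>i\<in>{1..n}. U.prob ((\<lambda>\<omega>. S \<omega> i) -` {s i} \<inter> space U))"
  proof (rule U.indep_varsD)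
    show "U.indep_vars (\<lambda>i. count_space {0, 1}) (\<lambda>i \<omega>. S \<omega> i) {1..n}"
      using S_cond_indep[OF \<gamma>] unfolding U_def E_def .
    show "{s i} \<in> sets (count_space {0, 1})" if "i \<in> {1..n}" for i
      using bin_vecsD[OF s that] by auto
  qed (use n in auto)
  also have "\<dots> = likelihood n a b \<gamma> s"
    unfolding likelihood_def using single
    by (intro prod.cong) (auto simp: space_U vimage_def Int_def conj_commute)
  finally have "U.prob {\<omega> \<in> space M. S \<omega> = s} = likelihood n a b \<gamma> s"
    unfolding inter .
  moreover have "{\<omega> \<in> space M. S \<omega> = s} \<inter> E = {\<omega> \<in> space M. T \<omega> = \<gamma> \<and> S \<omega> = s}"
    unfolding E_def by auto
  moreover have "real (card (placements n k)) > 0"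
    using \<gamma> by (auto simp: card_gt_0_iff)
  ultimately show ?thesis
    using U[of "{\<omega> \<in> space M. S \<omega> = s}"] S_event[of "\<lambda>t. t = s"] E(2) prob_placement[OF \<gamma>]
    unfolding E_def by (auto simp: eq_divide_eq mult.commute)
qed

lemma expectation_T_S:
  fixes f :: "(nat \<Rightarrow> nat) \<Rightarrow> (nat \<Rightarrow> nat) \<Rightarrow> real"
  assumes n: "n \<ge> 1"
  shows "(\<integral>\<omega>. f (T \<omega>) (S \<omega>) \<partial>M) =
    (\<Sum>s\<in>bin_vecs n. \<Sum>\<gamma>\<in>placements n k. f \<gamma> s * likelihood n a b \<gamma> s) / card (placements n k)"
proof -
  let ?A = "\<lambda>\<gamma> s. {\<omega> \<in> space M. T \<omega> = \<gamma> \<and> S \<omega> = s}"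
  have "(\<integral>\<omega>. f (T \<omega>) (S \<omega>) \<partial>M) =
      (\<integral>\<omega>. (\<Sum>s\<in>bin_vecs n. \<Sum>\<gamma>\<in>placements n k. f \<gamma> s * indicator (?A \<gamma> s) \<omega>) \<partial>M)"
  proof (rule Bochner_Integration.integral_cong)
    fix \<omega> assume \<omega>: "\<omega> \<in> space M"
    have "(\<Sum>s\<in>bin_vecs n. \<Sum>\<gamma>\<in>placements n k. f \<gamma> s * indicator (?A \<gamma> s) \<omega>) =
        (\<Sum>s\<in>bin_vecs n. if s = S \<omega> then \<Sum>\<gamma>\<in>placements n k. if \<gamma> = T \<omega> then f \<gamma> s else 0 else 0)"
      using \<omega> by (intro sum.cong) (auto simp: indicator_def intro!: sum.cong sum.neutral)
    also have "\<dots> = f (T \<omega>) (S \<omega>)"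
      using T_mem[OF \<omega>] S_mem[OF \<omega>] by simp
    finally show "f (T \<omega>) (S \<omega>) =
        (\<Sum>s\<in>bin_vecs n. \<Sum>\<gamma>\<in>placements n k. f \<gamma> s * indicator (?A \<gamma> s) \<omega>)" ..
  qed simp
  also have "\<dots> = (\<Sum>s\<in>bin_vecs n. \<Sum>\<gamma>\<in>placements n k. f \<gamma> s * prob (?A \<gamma> s))"
    using joint_event
    by (simp add: Bochner_Integration.integral_sum emeasure_eq_measure del: sum_mult_indicator)
  also have "\<dots> = (\<Sum>s\<in>bin_vecs n. \<Sum>\<gamma>\<in>placements n k. f \<gamma> s * likelihood n a b \<gamma> s / card (placements n k))"
    using prob_joint n by (intro sum.cong) auto
  finally show ?thesis
    by (simp add: sum_divide_distrib)
qed

text \<open>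
  The quotient of the two sums of likelihoods is the posterior mean reward. In the multiplied form the
  equation needs no case distinction: for \<open>s\<close> of probability \<open>0\<close>, where \<open>\<alpha>\<^sub>i(s)\<close> is a quotient by
  \<open>0\<close>, both sides vanish.
\<close>

lemma posterior_reward:
  assumes ab: "a \<in> {0..1}" "b \<in> {0..1}" and k: "k \<le> n"
    and s: "s \<in> bin_vecs n" and i: "i \<in> {1..n}"
  shows "(\<Sum>\<gamma>\<in>placements n k. (c i * of_bool (\<gamma> i = 1) - d i * of_bool (\<gamma> i = 0)) * likelihood n a b \<gamma> s) =
    (\<Sum>\<gamma>\<in>placements n k. likelihood n a b \<gamma> s) * R n k a b c d s i"
proof -
  define w where "w = (\<Sum>\<gamma>\<in>placements n k. likelihood n a b \<gamma> s)"
  define y where "y = (\<Sum>\<gamma> | \<gamma> \<in> placements n k \<and> \<gamma> i = 0. likelihood n a b \<gamma> s)"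
  have y: "y = \<alpha> n k a b s i * w"
  proof (cases "g a b n k (num_zeros n s) = 0")
    case True
    then have w: "w = 0"
      unfolding w_def by (rule sum_likelihood_eq_0[OF s ab])
    have "y \<le> w"
      unfolding y_def w_def using likelihood_nonneg[OF ab] by (intro sum_mono2) auto
    moreover have "y \<ge> 0"
      unfolding y_def using likelihood_nonneg[OF ab] by (intro sum_nonneg) auto
    ultimately show ?thesis using w by simp
  next
    case False
    then have "g a b n k (num_zeros n s) > 0"
      by (simp add: g_def pmf_pos)
    then show ?thesis
      unfolding y_def w_def by (rule sum_likelihood_empty_box_eq_\<alpha>[OF s i k ab])
  qed
  have "(\<Sum>\<gamma>\<in>placements n k. (c i * of_bool (\<gamma> i = 1) - d i * of_bool (\<gamma> i = 0)) * likelihood n a b \<gamma> s) =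
      (\<Sum>\<gamma>\<in>placements n k. c i * likelihood n a b \<gamma> s -
        (c i + d i) * (if \<gamma> i = 0 then likelihood n a b \<gamma> s else 0))"
  proof (rule sum.cong[OF refl])
    fix \<gamma> assume "\<gamma> \<in> placements n k"
    then have "\<gamma> i = 0 \<or> \<gamma> i = 1"
      using bin_vecsD[OF _ i] by (simp add: placements_def)
    then show "(c i * of_bool (\<gamma> i = 1) - d i * of_bool (\<gamma> i = 0)) * likelihood n a b \<gamma> s =
        c i * likelihood n a b \<gamma> s - (c i + d i) * (if \<gamma> i = 0 then likelihood n a b \<gamma> s else 0)"
      by (auto simp: algebra_simps)
  qed
  also have "\<dots> = c i * w - (c i + d i) * y"
    unfolding w_def y_def
    by (simp add: sum_subtractf sum.inter_filter flip: sum_distrib_left)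
  also have "\<dots> = w * R n k a b c d s i"
    unfolding R_def y by (simp add: algebra_simps)
  finally show ?thesis
    unfolding w_def .
qed

lemma expected_reward_eq:
  assumes ab: "a \<in> {0..1}" "b \<in> {0..1}" and k: "k \<le> n" and n: "n \<ge> 1"
    and J: "J \<in> strategies n m"
  shows "expected_reward M T S c d J =
    (\<Sum>s\<in>bin_vecs n. (\<Sum>\<gamma>\<in>placements n k. likelihood n a b \<gamma> s) * (\<Sum>i\<in>J s. R n k a b c d s i)) /
      card (placements n k)"
proof -
  let ?v = "\<lambda>\<gamma> i. c i * of_bool (\<gamma> i = 1) - d i * of_bool (\<gamma> i = 0)"
  have "(\<Sum>\<gamma>\<in>placements n k. (\<Sum>i\<in>J s. ?v \<gamma> i) * likelihood n a b \<gamma> s) =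
      (\<Sum>\<gamma>\<in>placements n k. likelihood n a b \<gamma> s) * (\<Sum>i\<in>J s. R n k a b c d s i)"
    if s: "s \<in> bin_vecs n" for s
  proof -
    have "J s \<subseteq> {1..n}" using J s unfolding strategies_def by auto
    then have "(\<Sum>i\<in>J s. \<Sum>\<gamma>\<in>placements n k. ?v \<gamma> i * likelihood n a b \<gamma> s) =
        (\<Sum>i\<in>J s. (\<Sum>\<gamma>\<in>placements n k. likelihood n a b \<gamma> s) * R n k a b c d s i)"
      using posterior_reward[OF ab k s] by (intro sum.cong) auto
    then show ?thesis
      unfolding sum_distrib_right sum_distrib_left
      by (subst sum.swap) (simp add: sum_distrib_left sum_distrib_right)
  qed
  then show ?thesis
    unfolding expected_reward_def
    using expectation_T_S[OF n, of "\<lambda>\<gamma> s. \<Sum>i\<in>J s. ?v \<gamma> i"] by simp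
qed

end

section \<open>Optimality\<close>

theorem theorem2:
  fixes M :: "'w measure" and T S :: "'w \<Rightarrow> nat \<Rightarrow> nat"
    and n k m :: nat and a b :: real and c d :: "nat \<Rightarrow> real"
    and I :: "(nat \<Rightarrow> nat) \<Rightarrow> nat set"
  assumes "1 \<le> n" and "k \<le> n" and "1 \<le> m" and "m \<le> n"
    and "a \<in> {1/2..1}" and "b \<in> {1/2..1}"
    and "symmetric_test_and_find M n k a b T S"
    and "I \<in> strategies n m"
    and "\<And>s. s \<in> bin_vecs n \<Longrightarrow> g a b n k (num_zeros n s) > 0 \<Longrightarrow>
           selects_best n m (R n k a b c d s) (I s)"
  shows "\<forall>J \<in> strategies n m. expected_reward M T S c d J \<le> expected_reward M T S c d I"
proof
  fix J assume J: "J \<in> strategies n m"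
  interpret symmetric_test_and_find M n k a b T S by fact
  have ab: "a \<in> {0..1}" "b \<in> {0..1}" using assms(5,6) by auto
  let ?w = "\<lambda>s. \<Sum>\<gamma>\<in>placements n k. likelihood n a b \<gamma> s"
  have "?w s * (\<Sum>i\<in>J s. R n k a b c d s i) \<le> ?w s * (\<Sum>i\<in>I s. R n k a b c d s i)"
    if s: "s \<in> bin_vecs n" for s
  proof (cases "g a b n k (num_zeros n s) = 0")
    case True
    then have "?w s = 0"
      by (rule sum_likelihood_eq_0[OF s ab])
    then show ?thesis by simp
  next
    case False
    then have "g a b n k (num_zeros n s) > 0"
      by (simp add: g_def pmf_pos)
    then have "selects_best n m (R n k a b c d s) (I s)"
      using assms(9) s by blast
    moreover have "J s \<subseteq> {1..n}" "card (J s) \<le> m"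
      using J s unfolding strategies_def by auto
    ultimately have "(\<Sum>i\<in>J s. R n k a b c d s i) \<le> (\<Sum>i\<in>I s. R n k a b c d s i)"
      by (rule selects_best_maximizes_sum)
    moreover have "?w s \<ge> 0"
      using likelihood_nonneg[OF ab] by (intro sum_nonneg) auto
    ultimately show ?thesis
      by (rule mult_left_mono)
  qed
  then show "expected_reward M T S c d J \<le> expected_reward M T S c d I"
    unfolding expected_reward_eq[OF ab assms(2,1) J] expected_reward_eq[OF ab assms(2,1,8)]
    by (intro divide_right_mono sum_mono) auto
qed

end
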